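(* Let $\alpha,\beta,\gamma>0$ and $\lambda\in\mathbb{R}$. The partial derivative $\frac{\partial}{\partial\alpha}\left(t^{\beta-1}E_{\alpha,\beta}^{\gamma}(\lambda t^{\alpha})\right)$ is a convoluted form with kernel of logarithmic type: $$\frac{\partial}{\partial\alpha}\left(t^{\beta-1}E_{\alpha,\beta}^{\gamma}(\lambda t^{\alpha})\right)=\gamma\lambda\int_0^t\left(\ln(t-t_1)+\gamma_0\right)t_1^{\alpha+\beta-2}\,E_{\alpha,\alpha+\beta-1}^{\gamma+1}(\lambda t_1^{\alpha})\,dt_1$$ for every $t\ge0$.
   Context: $E_{\alpha,\beta}^{\gamma}(z)=\sum_{k=0}^{\infty}\frac{(\gamma)_k\,z^k}{k!\,\Gamma(\alpha k+\beta)}$ is the Prabhakar function, where $(\gamma)_k=\gamma(\gamma+1)\cdots(\gamma+k-1)$, $(\gamma)_0=1$, and $1/\Gamma$ is taken to be $0$ at the poles of $\Gamma$. $\gamma_0$ is the Euler–Mascheroni constant (unrelated to the parameter $\gamma$).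
   Formalization: The condition α+β>1 is added: for α+β<1 the integral diverges (t>0, ln t≠−γ₀), and for α+β=1, λ≠0 the two sides differ by γλ(ln t+γ₀), so the stated identity fails there. *)

theory Defs
  imports "HOL-Analysis.Analysis"
begin

text \<open>
  \<^const>\<open>rGamma\<close> is the entire function \<open>1 / \<Gamma>\<close>, which vanishes at the poles of \<open>\<Gamma>\<close>.
  For \<open>\<alpha> > 0\<close> the series converges for all real \<open>\<beta>\<close>, \<open>\<gamma>\<close>, \<open>z\<close>.
\<close>

definition prabhakar :: "real \<Rightarrow> real \<Rightarrow> real \<Rightarrow> real \<Rightarrow> real" where
  "prabhakar \<alpha> \<beta> \<gamma> z =
     (\<Sum>k. pochhammer \<gamma> k * z ^ k / fact k * rGamma (\<alpha> * real k + \<beta>))"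

end

theory Submission
  imports Defs
begin

text \<open>
  Both sides of the identity are the sum of one and the same series. With \<open>x = \<alpha> k + \<beta>\<close>, the
  \<open>k\<close>-th term of \<open>t\<^sup>\<beta>\<^sup>-\<^sup>1 E(\<lambda> t\<^sup>\<alpha>)\<close> depends on \<open>\<alpha>\<close> through \<open>t\<^sup>x\<^sup>-\<^sup>1 / \<Gamma>(x)\<close>, whose derivative
  with respect to \<open>x\<close> is \<open>t\<^sup>x\<^sup>-\<^sup>1 / \<Gamma>(x) (ln t - \<psi>(x))\<close>, where \<open>\<psi>\<close> is the digamma function.
  The same expression is the convolution of the kernel \<open>ln + \<gamma>\<^sub>0\<close> with the
  power \<open>s\<^sup>x\<^sup>-\<^sup>2 / \<Gamma>(x - 1)\<close> for \<open>x > 1\<close> (lemma \<open>log_convolution_power\<close>): the logarithmic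
  series turns \<open>\<integral> ln (1 - s / t) s\<^sup>y\<^sup>-\<^sup>1 ds\<close> over \<open>[0, t]\<close> into the series of \<open>\<psi>(y + 1) + \<gamma>\<^sub>0\<close>,
  up to the factor \<open>- t\<^sup>y / y\<close> (lemma \<open>log_kernel_moment\<close>). The factor \<open>k\<close> of the inner derivative
  removes the term \<open>k = 0\<close>, and the shift \<open>k \<mapsto> k + 1\<close> turns the parameters \<open>\<beta>\<close>, \<open>\<gamma>\<close> into
  \<open>\<alpha> + \<beta> - 1\<close>, \<open>\<gamma> + 1\<close> with the factor \<open>\<gamma> \<lambda>\<close>.

  What remains is to justify termwise differentiation and termwise integration. For both, \<open>1 / \<Gamma>(x)\<close>
  decays faster than any geometric sequence, uniformly for \<open>\<alpha>\<close> bounded away from \<open>0\<close>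
  (lemma \<open>prabhakar_coeff_geometric_bound\<close>), whereas \<open>\<psi>(x)\<close> grows at most linearly. The
  assumption \<open>\<alpha> + \<beta> > 1\<close> makes the lowest power \<open>s\<^sup>\<alpha>\<^sup>+\<^sup>\<beta>\<^sup>-\<^sup>2\<close> integrable at \<open>0\<close>.
\<close>

section \<open>Decay of the coefficients\<close>

text \<open>
  The part of the Gamma integral \<open>\<Gamma>(x + 1) = \<integral> s\<^sup>x e\<^sup>-\<^sup>s ds\<close> over \<open>s \<ge> R\<close> alone gives
  \<open>\<Gamma>(x + 1) \<ge> R\<^sup>x e\<^sup>-\<^sup>R\<close>. Working with \<open>\<Gamma>(x + 1) = x \<Gamma>(x)\<close> keeps the exponent nonnegative, so that
  arguments below \<open>1\<close>, which occur for the first few coefficients, are covered as well.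
\<close>

lemma rGamma_le_powr:
  fixes x R :: real
  assumes "x > 0" "R > 0"
  shows "rGamma x \<le> x * exp R * R powr (-x)"
proof -
  have G: "((\<lambda>s. s powr (x + 1 - 1) / exp s) has_integral Gamma (x + 1)) {0..}"
    using Gamma_integral_real[of "x + 1"] assms by simp
  have E: "((\<lambda>s. R powr x * exp (- 1 * s)) has_integral R powr x * (exp (- 1 * R) / 1)) {R..}"
    by (intro has_integral_mult_right has_integral_exp_minus_to_infinity) simp
  have "R powr x * (exp (- 1 * R) / 1) \<le> Gamma (x + 1)"
  proof (rule has_integral_le[OF iffD2[OF has_integral_restrict_UNIV E] iffD2[OF has_integral_restrict_UNIV G]])
    fix s :: real
    show "(if s \<in> {R..} then R powr x * exp (- 1 * s) else 0)
        \<le> (if s \<in> {0..} then s powr (x + 1 - 1) / exp s else 0)"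
      using assms by (auto simp: exp_minus field_simps intro!: powr_mono2)
  qed
  also have "Gamma (x + 1) = x * Gamma x"
    using Gamma_plus1[of x] assms by (auto simp: nonpos_Ints_def)
  finally have "R powr x * exp (- R) \<le> x * Gamma x" by simp
  moreover have "Gamma x > 0" using assms by simp
  ultimately show ?thesis
    using assms by (simp add: rGamma_inverse_Gamma powr_minus exp_minus field_simps)
qed

text \<open>
  Because \<open>S\<close> is arbitrary, \<open>1 / \<Gamma>\<close> beats every geometric growth; the choice \<open>R = e S\<close> in the
  previous bound absorbs its factor \<open>x\<close>. The estimate depends on \<open>x\<close> only through a power of \<open>S\<close>,
  which is what makes bounds locally uniform in \<open>\<alpha>\<close> possible.
\<close>

lemma rGamma_superexponential_decay:
  fixes x S :: real
  assumes "x > 0" "S > 0"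
  shows "rGamma x \<le> exp (exp 1 * S) * S powr (-x)"
proof -
  have "rGamma x \<le> x * exp (exp 1 * S) * (exp 1 * S) powr (-x)"
    using assms by (intro rGamma_le_powr) auto
  also have "(exp 1 * S) powr (-x) = exp (-x) * S powr (-x)"
    using assms by (simp add: powr_mult exp_powr_real)
  also have "x * exp (exp 1 * S) * (exp (-x) * S powr (-x)) =
      (x * exp (-x)) * (exp (exp 1 * S) * S powr (-x))" by simp
  also have "\<dots> \<le> 1 * (exp (exp 1 * S) * S powr (-x))"
  proof (rule mult_right_mono)
    have "x \<le> exp x" using exp_ge_add_one_self[of x] by linarith
    then show "x * exp (-x) \<le> 1" by (simp add: exp_minus field_simps)
  qed simp
  finally show ?thesis by simp
qed

lemma pochhammer_over_fact_le:
  fixes \<gamma> :: real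
  assumes "\<gamma> > 0"
  shows "pochhammer \<gamma> k / fact k \<le> (1 + \<gamma>) ^ k"
proof (induction k)
  case (Suc k)
  have "pochhammer \<gamma> (Suc k) / fact (Suc k) = pochhammer \<gamma> k / fact k * ((\<gamma> + k) / (k + 1))"
    by (simp add: pochhammer_Suc add_ac)
  also have "\<dots> \<le> (1 + \<gamma>) ^ k * (1 + \<gamma>)"
    using assms Suc by (intro mult_mono) (auto simp: field_simps)
  finally show ?case by (simp add: mult.commute)
qed simp

text \<open>
  One constant \<open>K\<close> serves all \<open>a \<ge> a0\<close>: the growth \<open>(1 + \<gamma>)\<^sup>k L\<^sup>k\<close> of the other factors is
  beaten by \<open>S\<^sup>-\<^sup>a\<^sup>k\<close> once \<open>S\<^sup>a\<^sup>0\<close> exceeds twice its base. Polynomial factors in \<open>k\<close> can be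
  hidden in \<open>L\<close> by means of \<open>k \<le> 2\<^sup>k\<close>, so this single bound carries both the convergence of the
  series and the majorants for differentiation and integration.
\<close>

lemma prabhakar_coeff_geometric_bound:
  fixes a0 \<beta> \<gamma> L :: real
  assumes "a0 > 0" "\<beta> > 0" "\<gamma> > 0" "L \<ge> 0"
  obtains K where "\<And>k a. a \<ge> a0 \<Longrightarrow>
    pochhammer \<gamma> k / fact k * L ^ k * rGamma (a * real k + \<beta>) \<le> K * (1/2) ^ k"
proof
  define S where "S = (1 + 2 * (1 + \<gamma>) * L) powr (1 / a0)"
  have base: "1 + 2 * (1 + \<gamma>) * L \<ge> 1" using assms by simp
  have S1: "S \<ge> 1" unfolding S_def using base assms by (intro ge_one_powr_ge_zero) auto
  have Sa: "S powr a0 = 1 + 2 * (1 + \<gamma>) * L"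
    unfolding S_def using base assms by (simp add: powr_powr)
  fix k :: nat and a assume a: "a \<ge> a0"
  have pos: "a * real k + \<beta> > 0" using a assms by (intro add_nonneg_pos) auto
  have "rGamma (a * real k + \<beta>) \<le> exp (exp 1 * S) * S powr (- (a * real k + \<beta>))"
    using pos S1 by (intro rGamma_superexponential_decay) auto
  also have "\<dots> \<le> exp (exp 1 * S) * S powr (- (a0 * real k))"
  proof (intro mult_left_mono powr_mono)
    have "a0 * real k \<le> a * real k" using a by (intro mult_right_mono) auto
    then show "- (a * real k + \<beta>) \<le> - (a0 * real k)" using assms by linarith
  qed (use S1 in auto)
  also have "S powr (- (a0 * real k)) = (1 / (1 + 2 * (1 + \<gamma>) * L)) ^ k"
    using S1 Sa base by (simp add: powr_minus powr_powr[symmetric] powr_realpow field_simps)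
  finally have r: "rGamma (a * real k + \<beta>) \<le> exp (exp 1 * S) * (1 / (1 + 2 * (1 + \<gamma>) * L)) ^ k" .
  have "pochhammer \<gamma> k / fact k * L ^ k * rGamma (a * real k + \<beta>) \<le>
      ((1 + \<gamma>) ^ k * L ^ k) * (exp (exp 1 * S) * (1 / (1 + 2 * (1 + \<gamma>) * L)) ^ k)"
    using assms pos r
    by (intro mult_mono pochhammer_over_fact_le)
       (auto simp: rGamma_inverse_Gamma intro!: mult_nonneg_nonneg divide_nonneg_pos pochhammer_nonneg)
  also have "\<dots> = exp (exp 1 * S) * ((1 + \<gamma>) * L / (1 + 2 * (1 + \<gamma>) * L)) ^ k"
    by (simp add: power_mult_distrib power_divide)
  also have "\<dots> \<le> exp (exp 1 * S) * (1/2) ^ k"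
  proof (intro mult_left_mono power_mono)
    have "0 \<le> (1 + \<gamma>) * L" using assms by simp
    then show "(1 + \<gamma>) * L / (1 + 2 * (1 + \<gamma>) * L) \<le> 1 / 2"
      "0 \<le> (1 + \<gamma>) * L / (1 + 2 * (1 + \<gamma>) * L)"
      using base by (auto simp: pos_divide_le_eq algebra_simps)
  qed simp
  finally show "pochhammer \<gamma> k / fact k * L ^ k * rGamma (a * real k + \<beta>)
      \<le> exp (exp 1 * S) * (1/2) ^ k" .
qed

section \<open>The digamma function\<close>

lemma Digamma_plus_euler_sums:
  fixes y :: real
  assumes "y > 0"
  shows "(\<lambda>n. y / ((real n + 1) * (real n + 1 + y))) sums (Digamma (y + 1) + euler_mascheroni)"
proof -
  have "(\<lambda>n. inverse (real (Suc n)) - inverse (y + 1 + real n)) sums (Digamma (y + 1) + euler_mascheroni)"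
    using summable_sums[OF summable_Digamma[of "y + 1"]] assms by (simp add: Digamma_def)
  moreover have "inverse (real (Suc n)) - inverse (y + 1 + real n) = y / ((real n + 1) * (real n + 1 + y))" for n
    using assms by (simp add: divide_simps add_ac)
  ultimately show ?thesis by simp
qed

text \<open>
  Up to a linear factor, the digamma function contributes nothing to the growth of the terms;
  comparing the series above with \<open>y / (n + 1)\<^sup>2\<close> is enough for this.
\<close>

lemma Digamma_plus_euler_linear_bound:
  obtains C :: real where "C \<ge> 0" "\<And>y. y > 0 \<Longrightarrow>
    0 \<le> Digamma (y + 1) + euler_mascheroni \<and> Digamma (y + 1) + euler_mascheroni \<le> C * y"
proof
  have s: "summable (\<lambda>n. 1 / (real n + 1)^2)"
    using summable_Suc_iff[of "\<lambda>n. 1 / real n ^ 2"] inverse_power_summable[of 2, where 'a=real]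
    by (simp add: add.commute divide_inverse)
  show "(\<Sum>n. 1 / (real n + 1)^2) \<ge> 0" using s by (intro suminf_nonneg) auto
  fix y :: real assume y: "y > 0"
  note D = Digamma_plus_euler_sums[OF y]
  have "0 \<le> Digamma (y + 1) + euler_mascheroni"
    using y by (intro sums_le[OF _ sums_zero D]) auto
  moreover have "Digamma (y + 1) + euler_mascheroni \<le> (\<Sum>n. 1 / (real n + 1)^2) * y"
  proof (rule sums_le[OF _ D sums_mult2[OF summable_sums[OF s]]])
    fix n
    show "y / ((real n + 1) * (real n + 1 + y)) \<le> 1 / (real n + 1)^2 * y"
      using y unfolding power2_eq_square times_divide_eq_left
      by (simp, intro divide_left_mono) (auto intro!: mult_left_mono)
  qed
  ultimately show "0 \<le> Digamma (y + 1) + euler_mascheroni \<and>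
      Digamma (y + 1) + euler_mascheroni \<le> (\<Sum>n. 1 / (real n + 1)^2) * y" by simp
qed

text \<open>
  The logarithmic factors that appear in the \<open>k\<close>-th term, where \<open>y\<close> is affine in \<open>k\<close>, in the
  form \<open>D 2\<^sup>k\<close> that the geometric coefficient bound can absorb.
\<close>

lemma log_Digamma_growth:
  fixes t b :: real
  assumes "b \<ge> 0"
  obtains D where "D \<ge> 0" and "\<And>k y. 0 < y \<Longrightarrow> y \<le> b * (real k + 1) \<Longrightarrow>
    \<bar>ln t\<bar> + euler_mascheroni + (Digamma (y + 1) + euler_mascheroni) \<le> D * 2 ^ k"
proof -
  obtain C :: real where C: "C \<ge> 0" "\<And>y. y > 0 \<Longrightarrow>
    0 \<le> Digamma (y + 1) + euler_mascheroni \<and> Digamma (y + 1) + euler_mascheroni \<le> C * y"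
    using Digamma_plus_euler_linear_bound by blast
  define A where "A = \<bar>ln t\<bar> + (euler_mascheroni :: real)"
  have A: "A \<ge> 0" using euler_mascheroni_pos by (simp add: A_def)
  show thesis
  proof (rule that)
    show "A + C * b \<ge> 0" using A C assms by simp
    fix k y assume y: "0 < y" "y \<le> b * (real k + 1)"
    have k: "real k + 1 \<le> 2 ^ k"
      using of_nat_less_two_power[of k, where 'a=real] Suc_leI[OF less_exp[of k]]
      by (metis of_nat_Suc of_nat_le_iff of_nat_numeral of_nat_power add.commute)
    have "Digamma (y + 1) + euler_mascheroni \<le> C * y" using C(2) y by blast
    also have "\<dots> \<le> C * (b * 2 ^ k)"
      using y k C(1) assms by (intro mult_left_mono order.trans[OF y(2)]) auto
    finally have "Digamma (y + 1) + euler_mascheroni \<le> C * b * 2 ^ k" by simp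
    moreover have "A * 1 \<le> A * 2 ^ k" using A by (intro mult_left_mono) auto
    ultimately show "\<bar>ln t\<bar> + euler_mascheroni + (Digamma (y + 1) + euler_mascheroni)
        \<le> (A + C * b) * 2 ^ k"
      by (simp add: A_def algebra_simps)
  qed
qed

section \<open>The logarithmic kernel against a power\<close>

text \<open>
  Fubini for a series and an absolute integral. The null set \<open>N\<close> allows the expansion to fail, for
  instance, at the endpoint where the logarithm blows up.
\<close>

lemma termwise_integral_sums:
  fixes f :: "nat \<Rightarrow> real \<Rightarrow> real"
  assumes f: "\<And>k. f k absolutely_integrable_on S"
    and J: "summable (\<lambda>k. integral S (\<lambda>x. \<bar>f k x\<bar>))"
    and N: "negligible N"
    and F: "\<And>x. x \<in> S - N \<Longrightarrow> (\<lambda>k. f k x) sums F x"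
    and A: "\<And>x. x \<in> S - N \<Longrightarrow> summable (\<lambda>k. \<bar>f k x\<bar>)"
  shows "F absolutely_integrable_on S" "(\<lambda>k. integral S (f k)) sums integral S F"
proof -
  define g where "g k x = indicator S x *\<^sub>R f k x" for k x
  have gi: "integrable lebesgue (g k)" for k
    using f[of k] by (simp add: set_integrable_def g_def[abs_def])
  have ae: "AE x in lebesgue. x \<notin> N"
    using N by (simp add: negligible_iff_null_sets AE_not_in)
  have gs: "AE x in lebesgue. summable (\<lambda>k. norm (g k x))"
    using ae by eventually_elim (use A in \<open>auto simp: g_def indicator_def\<close>)
  have gn: "(\<integral>x. norm (g k x) \<partial>lebesgue) = integral S (\<lambda>x. \<bar>f k x\<bar>)" for k
  proof -
    have "(\<lambda>x. \<bar>f k x\<bar>) absolutely_integrable_on S"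
      using absolutely_integrable_norm[OF f[of k]] by (simp add: o_def)
    from set_lebesgue_integral_eq_integral(2)[OF this] show ?thesis
      by (simp add: set_lebesgue_integral_def g_def abs_mult)
  qed
  have gJ: "summable (\<lambda>k. \<integral>x. norm (g k x) \<partial>lebesgue)" using J gn by simp
  have gF: "(\<Sum>k. g k x) = indicator S x *\<^sub>R (\<Sum>k. f k x)" for x
    by (cases "x \<in> S") (auto simp: g_def)
  define H where "H x = (\<Sum>k. f k x)" for x
  have H: "H absolutely_integrable_on S"
    using integrable_suminf[OF gi gs gJ] by (simp add: gF H_def set_integrable_def)
  have FH: "F x = H x" if "x \<in> S - N" for x
    using F[OF that] by (simp add: H_def sums_iff)
  show "F absolutely_integrable_on S"
    by (rule absolutely_integrable_spike[OF H N FH])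
  have "(\<lambda>k. integral\<^sup>L lebesgue (g k)) sums (\<integral>x. (\<Sum>k. g k x) \<partial>lebesgue)"
    by (rule sums_integral[OF gi gs gJ])
  moreover have "integral\<^sup>L lebesgue (g k) = integral S (f k)" for k
    using set_lebesgue_integral_eq_integral(2)[OF f[of k]] by (simp add: set_lebesgue_integral_def g_def[abs_def])
  moreover have "(\<integral>x. (\<Sum>k. g k x) \<partial>lebesgue) = integral S H"
    using set_lebesgue_integral_eq_integral(2)[OF H] by (simp add: set_lebesgue_integral_def gF H_def)
  moreover have "integral S H = integral S F"
    by (rule integral_spike[OF N]) (use FH in auto)
  ultimately show "(\<lambda>k. integral S (f k)) sums integral S F" by simp
qed

text \<open>
  Expanding \<open>-ln (1 - s / t)\<close> into \<open>\<Sum> (s / t)\<^sup>n\<^sup>+\<^sup>1 / (n + 1)\<close> and integrating against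
  \<open>s\<^sup>y\<^sup>-\<^sup>1\<close> produces \<open>t\<^sup>y / ((n + 1) (n + 1 + y))\<close>, whose sum is the series of the digamma
  function. All terms have one sign, so convergence of the integrals suffices for the exchange.
\<close>

lemma log_kernel_moment:
  fixes t y :: real
  assumes t: "t > 0" and y: "y > 0"
  shows "(\<lambda>s. ln (1 - s / t) * s powr (y - 1)) absolutely_integrable_on {0..t}"
    and "integral {0..t} (\<lambda>s. ln (1 - s / t) * s powr (y - 1))
           = - (t powr y / y * (Digamma (y + 1) + euler_mascheroni))"
proof -
  define f where "f n s = s powr (y - 1) * ((s / t) ^ Suc n / real (Suc n))" for n s
  have f_nonneg: "f n s \<ge> 0" if "s \<in> {0..t}" for n s
    using that t by (simp add: f_def)
  have f_int: "(f n has_integral t powr y / ((real n + 1) * (real n + 1 + y))) {0..t}" for n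
  proof -
    have "((\<lambda>s. s powr (y + real n) / (t ^ Suc n * real (Suc n))) has_integral
        (t powr (y + real n + 1) / (y + real n + 1)) / (t ^ Suc n * real (Suc n))) {0..t}"
      using t y by (intro has_integral_divide has_integral_powr_from_0) auto
    also have "(t powr (y + real n + 1) / (y + real n + 1)) / (t ^ Suc n * real (Suc n))
        = t powr y / ((real n + 1) * (real n + 1 + y))"
    proof -
      have "t powr (y + real n + 1) = t powr y * t ^ Suc n"
        using t powr_add[of t y "real (Suc n)"] powr_realpow[of t "Suc n"] by (simp add: add_ac)
      then show ?thesis using t by (simp add: add_ac mult_ac)
    qed
    finally show ?thesis
    proof (rule has_integral_eq[rotated])
      fix s assume s: "s \<in> {0..t}"
      show "s powr (y + real n) / (t ^ Suc n * real (Suc n)) = f n s"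
      proof (cases "s = 0")
        case False
        then have "s powr (y + real n) = s powr (y - 1) * s ^ Suc n"
          using s powr_add[of s "y - 1" "real (Suc n)"] powr_realpow[of s "Suc n"]
          by (simp add: add_ac)
        then show ?thesis by (simp add: f_def power_divide)
      qed (simp add: f_def)
    qed
  qed
  have f_abs: "f n absolutely_integrable_on {0..t}" for n
    using f_int f_nonneg by (intro nonnegative_absolutely_integrable_1) auto
  have f_abs_int: "integral {0..t} (\<lambda>s. \<bar>f n s\<bar>) = integral {0..t} (f n)" for n
    by (intro integral_cong) (use f_nonneg in auto)
  have "(\<lambda>n. t powr y / y * (y / ((real n + 1) * (real n + 1 + y)))) sums
      (t powr y / y * (Digamma (y + 1) + euler_mascheroni))"
    by (intro sums_mult Digamma_plus_euler_sums y)
  then have ints: "(\<lambda>n. integral {0..t} (f n)) sums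
      (t powr y / y * (Digamma (y + 1) + euler_mascheroni))"
    using y integral_unique[OF f_int] by simp
  define F where "F s = - (ln (1 - s / t) * s powr (y - 1))" for s
  have log_series: "(\<lambda>n. f n s) sums F s" if s: "s \<in> {0..t} - {t}" for s
  proof -
    have "\<bar>- (s / t)\<bar> < 1" using s t by simp
    from ln_series'[OF this] have "(\<lambda>n. - ((s / t) ^ n / real n)) sums ln (1 - s / t)"
      by simp
    then have "(\<lambda>n. - ((s / t) ^ Suc n / real (Suc n))) sums ln (1 - s / t)"
      by (subst sums_Suc_iff) simp
    from sums_mult[OF sums_minus[OF this], of "s powr (y - 1)"]
    show ?thesis by (simp add: f_def F_def mult.commute del: power_Suc of_nat_Suc)
  qed
  have log_series_abs: "summable (\<lambda>n. \<bar>f n s\<bar>)" if "s \<in> {0..t} - {t}" for s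
    using log_series[OF that] f_nonneg[of s] that by (simp add: sums_iff)
  have "summable (\<lambda>n. integral {0..t} (\<lambda>s. \<bar>f n s\<bar>))"
    using ints by (simp add: f_abs_int sums_iff)
  note T = termwise_integral_sums[OF f_abs this negligible_sing log_series log_series_abs]
  have F_int: "integral {0..t} F = t powr y / y * (Digamma (y + 1) + euler_mascheroni)"
    using sums_unique2[OF T(2) ints] .
  have minus_F: "(\<lambda>s. ln (1 - s / t) * s powr (y - 1)) = (\<lambda>s. - 1 * F s)"
    by (simp add: F_def)
  show "(\<lambda>s. ln (1 - s / t) * s powr (y - 1)) absolutely_integrable_on {0..t}"
    unfolding minus_F using T(1) by (intro set_integrable_mult_right) auto
  show "integral {0..t} (\<lambda>s. ln (1 - s / t) * s powr (y - 1))
      = - (t powr y / y * (Digamma (y + 1) + euler_mascheroni))"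
    unfolding minus_F integral_mult_right F_int by simp
qed

text \<open>
  Since \<open>ln (t - s) = ln t + ln (1 - s / t)\<close>, the constant \<open>\<gamma>\<^sub>0\<close> in the kernel cancels exactly
  the one produced by the digamma series. The last part, a bound on the absolute integral of the same
  order, is what later permits summation over the terms of the Prabhakar series.
\<close>

lemma log_convolution_power:
  fixes t y :: real
  assumes t: "t > 0" and y: "y > 0"
  defines "h \<equiv> \<lambda>s. (ln (t - s) + euler_mascheroni) * s powr (y - 1)"
  shows "h absolutely_integrable_on {0..t}"
    and "integral {0..t} h = t powr y / y * (ln t - Digamma (y + 1))"
    and "integral {0..t} (\<lambda>s. \<bar>h s\<bar>) \<le> t powr y / y *
           (\<bar>ln t\<bar> + euler_mascheroni + (Digamma (y + 1) + euler_mascheroni))"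
proof -
  define p where "p s = s powr (y - 1)" for s
  define q where "q s = ln (1 - s / t) * s powr (y - 1)" for s
  note q = log_kernel_moment[OF t y, folded q_def]
  have p_int: "(p has_integral (t powr y / y)) {0..t}"
    using has_integral_powr_from_0[of "y - 1" t] t y by (simp add: p_def[abs_def])
  have p_abs: "p absolutely_integrable_on {0..t}"
    using p_int by (intro nonnegative_absolutely_integrable_1) (auto simp: p_def)
  have q_int: "(q has_integral - (t powr y / y * (Digamma (y + 1) + euler_mascheroni))) {0..t}"
    using q set_lebesgue_integral_eq_integral(1) by (simp add: has_integral_iff)
  have split: "h s = (ln t + euler_mascheroni) * p s + q s" if s: "s \<in> {0..t} - {t}" for s
  proof -
    have "ln (t - s) = ln (t * (1 - s / t))" using t by (simp add: algebra_simps)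
    also have "\<dots> = ln t + ln (1 - s / t)" using s t by (subst ln_mult) auto
    finally show ?thesis by (simp add: h_def p_def q_def algebra_simps)
  qed
  have H_abs: "(\<lambda>s. (ln t + euler_mascheroni) * p s + q s) absolutely_integrable_on {0..t}"
    using p_abs q(1) by (intro set_integral_add) auto
  then show h_abs: "h absolutely_integrable_on {0..t}"
    by (rule absolutely_integrable_spike[OF _ negligible_sing split])
  have "((\<lambda>s. (ln t + euler_mascheroni) * p s + q s) has_integral
      ((ln t + euler_mascheroni) * (t powr y / y)
        + - (t powr y / y * (Digamma (y + 1) + euler_mascheroni)))) {0..t}"
    by (intro has_integral_add has_integral_mult_right p_int q_int)
  then have "(h has_integral
      ((ln t + euler_mascheroni) * (t powr y / y)
        + - (t powr y / y * (Digamma (y + 1) + euler_mascheroni)))) {0..t}"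
    by (rule has_integral_spike[OF negligible_sing[of t], rotated]) (use split in auto)
  then show "integral {0..t} h = t powr y / y * (ln t - Digamma (y + 1))"
    by (simp add: integral_unique algebra_simps add_divide_distrib)
  \<comment> \<open>Since \<open>q \<le> 0\<close>, the absolute value of \<open>h\<close> is at most this function.\<close>
  have majorant: "((\<lambda>s. (\<bar>ln t\<bar> + euler_mascheroni) * p s - q s) has_integral
      ((\<bar>ln t\<bar> + euler_mascheroni) * (t powr y / y)
        - - (t powr y / y * (Digamma (y + 1) + euler_mascheroni)))) {0..t}"
    by (intro has_integral_diff has_integral_mult_right p_int q_int)
  have abs_int: "((\<lambda>s. \<bar>h s\<bar>) has_integral integral {0..t} (\<lambda>s. \<bar>h s\<bar>)) {0..t}"
    using h_abs by (simp add: absolutely_integrable_on_def integrable_integral)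
  \<comment> \<open>The decomposition of the logarithm fails at \<open>s = t\<close>, so the integrand is redefined there.\<close>
  have abs_int': "((\<lambda>s. if s = t then 0 else \<bar>h s\<bar>) has_integral integral {0..t} (\<lambda>s. \<bar>h s\<bar>)) {0..t}"
    by (rule has_integral_spike[OF negligible_sing[of t] _ abs_int]) auto
  have "integral {0..t} (\<lambda>s. \<bar>h s\<bar>) \<le> (\<bar>ln t\<bar> + euler_mascheroni) * (t powr y / y)
        - - (t powr y / y * (Digamma (y + 1) + euler_mascheroni))"
  proof (rule has_integral_le[OF abs_int' majorant])
    fix s assume s: "s \<in> {0..t}"
    have p0: "p s \<ge> 0" by (simp add: p_def)
    have q0: "q s \<le> 0"
    proof (cases "s = t")
      case False
      then have "1 - s / t > 0" "s / t \<ge> 0" using s t by auto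
      then have "ln (1 - s / t) \<le> 0" using ln_le_minus_one[of "1 - s / t"] by linarith
      then show ?thesis unfolding q_def by (intro mult_nonpos_nonneg) auto
    qed (use t in \<open>simp add: q_def\<close>)
    have "\<bar>ln t + euler_mascheroni\<bar> \<le> \<bar>ln t\<bar> + (euler_mascheroni :: real)"
      using euler_mascheroni_pos by linarith
    then have "\<bar>(ln t + euler_mascheroni) * p s\<bar> \<le> (\<bar>ln t\<bar> + euler_mascheroni) * p s"
      using p0 by (simp add: abs_mult mult_right_mono)
    moreover have "0 \<le> (\<bar>ln t\<bar> + euler_mascheroni) * p s"
      using p0 euler_mascheroni_pos by simp
    ultimately show "(if s = t then 0 else \<bar>h s\<bar>) \<le> (\<bar>ln t\<bar> + euler_mascheroni) * p s - q s"
      using split[of s] s q0 by auto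
  qed
  then show "integral {0..t} (\<lambda>s. \<bar>h s\<bar>) \<le> t powr y / y *
      (\<bar>ln t\<bar> + euler_mascheroni + (Digamma (y + 1) + euler_mascheroni))"
    by (simp add: algebra_simps add_divide_distrib)
qed

section \<open>Differentiation in the first parameter\<close>

text \<open>
  The \<open>\<alpha>\<close>-derivative of the \<open>k\<close>-th term of \<open>t\<^sup>\<beta>\<^sup>-\<^sup>1 E(\<lambda> t\<^sup>\<alpha>)\<close>; both sides of the final identity
  are compared with the sum of these.
\<close>

definition prabhakar_deriv_term :: "real \<Rightarrow> real \<Rightarrow> real \<Rightarrow> real \<Rightarrow> nat \<Rightarrow> real \<Rightarrow> real" where
  "prabhakar_deriv_term \<beta> \<gamma> lam t k a =
     pochhammer \<gamma> k / fact k * lam ^ k * real k * t powr (a * real k + \<beta> - 1)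
       * rGamma (a * real k + \<beta>) * (ln t - Digamma (a * real k + \<beta>))"

lemma summable_prabhakar_abs:
  fixes \<alpha> \<beta> \<gamma> z :: real
  assumes "\<alpha> > 0" "\<beta> > 0" "\<gamma> > 0"
  shows "summable (\<lambda>k. \<bar>pochhammer \<gamma> k * z ^ k / fact k * rGamma (\<alpha> * real k + \<beta>)\<bar>)"
proof -
  obtain K where K: "\<And>k a. a \<ge> \<alpha> \<Longrightarrow>
      pochhammer \<gamma> k / fact k * \<bar>z\<bar> ^ k * rGamma (a * real k + \<beta>) \<le> K * (1/2) ^ k"
    using prabhakar_coeff_geometric_bound[of \<alpha> \<beta> \<gamma> "\<bar>z\<bar>"] assms by auto
  show ?thesis
  proof (rule summable_comparison_test'[of "\<lambda>k. K * (1/2) ^ k" 0])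
    show "summable (\<lambda>k. K * (1/2) ^ k)" by (intro summable_mult summable_geometric) simp
    fix k :: nat
    have "rGamma (\<alpha> * real k + \<beta>) \<ge> 0"
      using assms by (simp add: rGamma_inverse_Gamma add_nonneg_pos Gamma_real_nonneg)
    then have "norm \<bar>pochhammer \<gamma> k * z ^ k / fact k * rGamma (\<alpha> * real k + \<beta>)\<bar>
        = pochhammer \<gamma> k / fact k * \<bar>z\<bar> ^ k * rGamma (\<alpha> * real k + \<beta>)"
      using assms by (simp add: abs_mult power_abs pochhammer_nonneg)
    also have "\<dots> \<le> K * (1/2) ^ k" using K by simp
    finally show "norm \<bar>pochhammer \<gamma> k * z ^ k / fact k * rGamma (\<alpha> * real k + \<beta>)\<bar> \<le> K * (1/2) ^ k" .
  qed
qed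

lemma prabhakar_sums:
  fixes \<alpha> \<beta> \<gamma> z :: real
  assumes "\<alpha> > 0" "\<beta> > 0" "\<gamma> > 0"
  shows "(\<lambda>k. pochhammer \<gamma> k * z ^ k / fact k * rGamma (\<alpha> * real k + \<beta>)) sums prabhakar \<alpha> \<beta> \<gamma> z"
  unfolding prabhakar_def
  by (rule summable_sums[OF summable_rabs_cancel[OF summable_prabhakar_abs[OF assms]]])

lemma powr_rGamma_has_derivative:
  fixes t c x :: real
  assumes "t > 0" "a * c + \<beta> > 0"
  shows "((\<lambda>a. t powr (a * c + \<beta> - 1) * rGamma (a * c + \<beta>)) has_real_derivative
     c * t powr (a * c + \<beta> - 1) * rGamma (a * c + \<beta>) * (ln t - Digamma (a * c + \<beta>)))
     (at a within S)"
proof -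
  have "a * c + \<beta> \<notin> \<int>\<^sub>\<le>\<^sub>0" using assms by (auto elim!: nonpos_Ints_cases)
  then have R: "((\<lambda>a. rGamma (a * c + \<beta>)) has_real_derivative
      - rGamma (a * c + \<beta>) * Digamma (a * c + \<beta>) * c) (at a within S)"
    by (auto intro!: derivative_eq_intros)
  have "((\<lambda>a. exp ((a * c + \<beta> - 1) * ln t)) has_real_derivative
      exp ((a * c + \<beta> - 1) * ln t) * (c * ln t)) (at a within S)"
    by (auto intro!: derivative_eq_intros)
  then have P: "((\<lambda>a. t powr (a * c + \<beta> - 1)) has_real_derivative
      t powr (a * c + \<beta> - 1) * (c * ln t)) (at a within S)"
    using assms by (simp add: powr_def)
  from DERIV_mult[OF P R] show ?thesis by (simp add: algebra_simps)
qed

text \<open>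
  Weierstrass majorants near a given \<open>\<alpha>\<close>. The condition \<open>a0 + \<beta> > 1\<close> keeps every Gamma argument
  with \<open>k \<ge> 1\<close> above \<open>1\<close>, where the linear bound on the digamma function applies; the term
  \<open>k = 0\<close> vanishes. The factor \<open>4\<close> in the coefficient bound absorbs one \<open>2\<^sup>k\<close> for the factor \<open>k\<close>
  and one for the digamma function.
\<close>

lemma prabhakar_deriv_term_bound:
  fixes \<alpha> \<beta> \<gamma> lam t a0 a1 :: real
  assumes "a0 > 0" "\<beta> > 0" "\<gamma> > 0" "t > 0" "a0 + \<beta> > 1" "a0 \<le> a1"
  obtains M where "summable M"
    and "\<And>k a. a \<in> {a0..a1} \<Longrightarrow> \<bar>prabhakar_deriv_term \<beta> \<gamma> lam t k a\<bar> \<le> M k"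
proof -
  define T where "T = max 1 t powr a1"
  have T: "T \<ge> 1" unfolding T_def using assms by (intro ge_one_powr_ge_zero) auto
  obtain D where D: "D \<ge> 0" "\<And>k y. 0 < y \<Longrightarrow> y \<le> (a1 + \<beta>) * (real k + 1) \<Longrightarrow>
    \<bar>ln t\<bar> + euler_mascheroni + (Digamma (y + 1) + euler_mascheroni) \<le> D * 2 ^ k"
    using log_Digamma_growth[of "a1 + \<beta>" t] assms by auto
  obtain K where K: "\<And>k a. a \<ge> a0 \<Longrightarrow>
      pochhammer \<gamma> k / fact k * (4 * \<bar>lam\<bar> * T) ^ k * rGamma (a * real k + \<beta>) \<le> K * (1/2) ^ k"
    using prabhakar_coeff_geometric_bound[of a0 \<beta> \<gamma> "4 * \<bar>lam\<bar> * T"] assms T by auto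
  define M where "M k = t powr (\<beta> - 1) * D * (K * (1/2) ^ k)" for k
  have "summable M" unfolding M_def by (intro summable_mult summable_geometric) simp
  moreover have "\<bar>prabhakar_deriv_term \<beta> \<gamma> lam t k a\<bar> \<le> M k" if a: "a \<in> {a0..a1}" for k a
  proof -
    define x where "x = a * real k + \<beta>"
    have x0: "x > 0" using a assms unfolding x_def by (intro add_nonneg_pos) auto
    have r0: "rGamma x \<ge> 0" using x0 by (simp add: rGamma_inverse_Gamma Gamma_real_nonneg)
    have tk: "t powr (x - 1) \<le> t powr (\<beta> - 1) * T ^ k"
    proof -
      have "t powr (x - 1) = t powr (\<beta> - 1) * t powr (a * real k)"
        by (simp add: x_def powr_add[symmetric] algebra_simps)
      also have "t powr (a * real k) \<le> max 1 t powr (a * real k)"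
        using a assms by (intro powr_mono2) auto
      also have "\<dots> \<le> max 1 t powr (a1 * real k)"
        using a by (intro powr_mono mult_right_mono) auto
      also have "\<dots> = T ^ k"
        using T by (simp add: T_def powr_powr[symmetric] powr_realpow)
      finally show ?thesis by (simp add: mult_left_mono)
    qed
    have log: "real k * \<bar>ln t - Digamma x\<bar> \<le> 2 ^ k * (D * 2 ^ k)"
    proof (cases "k = 0")
      case False
      then have k1: "real k \<ge> 1" by simp
      have "a0 * 1 \<le> a * real k" using a assms k1 by (intro mult_mono) auto
      then have y: "x - 1 > 0" using assms by (simp add: x_def)
      have "x - 1 \<le> (a1 + \<beta>) * (real k + 1)"
      proof -
        have "a * real k \<le> a1 * real k" using a by (intro mult_right_mono) auto
        moreover have "0 \<le> \<beta> * real k" using assms by simp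
        moreover have "(a1 + \<beta>) * (real k + 1) = a1 * real k + \<beta> * real k + a1 + \<beta>"
          by (simp add: algebra_simps)
        ultimately show ?thesis using assms unfolding x_def by linarith
      qed
      from D(2)[OF y this]
      have "\<bar>ln t\<bar> + euler_mascheroni + (Digamma x + euler_mascheroni) \<le> D * 2 ^ k" by simp
      moreover have "Digamma x + euler_mascheroni \<ge> 0"
        using Digamma_real_mono[of 1 x] y by simp
      ultimately have "\<bar>ln t - Digamma x\<bar> \<le> D * 2 ^ k"
        using euler_mascheroni_pos by linarith
      then show ?thesis
        using D(1) by (intro mult_mono less_imp_le[OF of_nat_less_two_power]) auto
    qed (use D in auto)
    have "\<bar>prabhakar_deriv_term \<beta> \<gamma> lam t k a\<bar> =
        (pochhammer \<gamma> k / fact k * \<bar>lam\<bar> ^ k * rGamma x) * t powr (x - 1) * (real k * \<bar>ln t - Digamma x\<bar>)"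
      unfolding prabhakar_deriv_term_def x_def[symmetric]
      using assms r0 by (simp add: abs_mult power_abs pochhammer_nonneg mult_ac)
    also have "\<dots> \<le> (pochhammer \<gamma> k / fact k * \<bar>lam\<bar> ^ k * rGamma x)
        * (t powr (\<beta> - 1) * T ^ k) * (2 ^ k * (D * 2 ^ k))"
      using assms r0 T by (intro mult_mono log tk mult_nonneg_nonneg) (auto intro!: pochhammer_nonneg divide_nonneg_pos)
    also have "\<dots> = t powr (\<beta> - 1) * D *
        (pochhammer \<gamma> k / fact k * (4 * \<bar>lam\<bar> * T) ^ k * rGamma x)"
    proof -
      have "(4::real) ^ k = 2 ^ k * 2 ^ k" by (simp add: power_mult_distrib[symmetric])
      then show ?thesis by (simp add: power_mult_distrib)
    qed
    also have "\<dots> \<le> M k"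
      unfolding M_def x_def using a D(1) by (intro mult_left_mono K) auto
    finally show ?thesis .
  qed
  ultimately show thesis by (rule that)
qed

lemma prabhakar_times_powr_has_derivative:
  fixes \<alpha> \<beta> \<gamma> lam t :: real
  assumes "\<alpha> > 0" "\<beta> > 0" "\<gamma> > 0" "\<alpha> + \<beta> > 1" "t > 0"
  shows "((\<lambda>a. t powr (\<beta> - 1) * prabhakar a \<beta> \<gamma> (lam * t powr a)) has_real_derivative
    (\<Sum>k. prabhakar_deriv_term \<beta> \<gamma> lam t k \<alpha>)) (at \<alpha>)"
proof -
  \<comment> \<open>Room below \<open>\<alpha>\<close> that keeps both \<open>a > 0\<close> and \<open>a + \<beta> > 1\<close>.\<close>
  obtain a0 where a0: "a0 > max 0 (1 - \<beta>)" "a0 < \<alpha>"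
    using dense[of "max 0 (1 - \<beta>)" \<alpha>] assms by auto
  define a1 where "a1 = \<alpha> + 1"
  define f where "f k a = pochhammer \<gamma> k / fact k * lam ^ k
     * (t powr (a * real k + \<beta> - 1) * rGamma (a * real k + \<beta>))" for k a
  have f_eq: "f k a = t powr (\<beta> - 1) *
      (pochhammer \<gamma> k * (lam * t powr a) ^ k / fact k * rGamma (a * real k + \<beta>))" for k a
  proof -
    have "t powr (a * real k + \<beta> - 1) = t powr (\<beta> - 1) * (t powr a) ^ k"
      using assms by (simp add: powr_realpow[symmetric] powr_powr powr_add[symmetric] algebra_simps)
    then show ?thesis by (simp add: f_def power_mult_distrib)
  qed
  have f_sums: "(\<lambda>k. f k a) sums (t powr (\<beta> - 1) * prabhakar a \<beta> \<gamma> (lam * t powr a))" if "a > 0" for a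
    unfolding f_eq using that assms by (intro sums_mult prabhakar_sums) auto
  obtain M where M: "summable M"
    "\<And>k a. a \<in> {a0..a1} \<Longrightarrow> \<bar>prabhakar_deriv_term \<beta> \<gamma> lam t k a\<bar> \<le> M k"
    using prabhakar_deriv_term_bound[of a0 \<beta> \<gamma> t a1 lam] a0 assms by (auto simp: a1_def)
  have "((\<lambda>a. \<Sum>k. f k a) has_real_derivative (\<Sum>k. prabhakar_deriv_term \<beta> \<gamma> lam t k \<alpha>)) (at \<alpha>)"
  proof (rule has_field_derivative_series'(2)[of "{a0..a1}" f])
    show "(f k has_real_derivative prabhakar_deriv_term \<beta> \<gamma> lam t k a) (at a within {a0..a1})"
      if "a \<in> {a0..a1}" for k a
    proof -
      have "a * real k + \<beta> > 0" using that a0 assms by (intro add_nonneg_pos) auto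
      from DERIV_cmult[OF powr_rGamma_has_derivative[OF \<open>t > 0\<close> this],
          of "pochhammer \<gamma> k / fact k * lam ^ k"]
      show ?thesis unfolding f_def prabhakar_deriv_term_def by (simp only: mult.assoc)
    qed
    show "uniformly_convergent_on {a0..a1} (\<lambda>n a. \<Sum>i<n. prabhakar_deriv_term \<beta> \<gamma> lam t i a)"
      using M by (intro Weierstrass_m_test') auto
    show "\<alpha> \<in> {a0..a1}" "\<alpha> \<in> interior {a0..a1}" using a0 by (auto simp: a1_def)
    show "summable (\<lambda>k. f k \<alpha>)" using f_sums[of \<alpha>] assms by (simp add: sums_iff)
  qed simp
  then show ?thesis
  proof (rule has_field_derivative_transform_within_open[of _ _ _ "{0<..}"])
    show "(\<Sum>k. f k a) = t powr (\<beta> - 1) * prabhakar a \<beta> \<gamma> (lam * t powr a)" if "a \<in> {0<..}" for a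
      using f_sums[of a] that by (simp add: sums_iff)
  qed (use assms in auto)
qed

section \<open>Evaluation of the convolution\<close>

text \<open>
  Each term of the series for \<open>E\<close> contributes a power \<open>s\<^sup>y\<^sup>-\<^sup>1\<close> with \<open>y = \<alpha> k + \<alpha> + \<beta> - 1\<close>,
  and \<open>1 / (y \<Gamma>(y)) = 1 / \<Gamma>(y + 1)\<close> with \<open>y + 1 = \<alpha> (k + 1) + \<beta>\<close>. So the \<open>k\<close>-th integral is the
  derivative term of index \<open>k + 1\<close>; the raised parameter \<open>\<gamma> + 1\<close> fits because
  \<open>\<gamma> (\<gamma> + 1)\<^sub>k = (\<gamma>)\<^sub>k\<^sub>+\<^sub>1\<close>.
\<close>

lemma prabhakar_log_convolution:
  fixes \<alpha> \<beta> \<gamma> lam t :: real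
  assumes "\<alpha> > 0" "\<beta> > 0" "\<gamma> > 0" "\<alpha> + \<beta> > 1" "t > 0"
  defines "F \<equiv> \<lambda>s. (ln (t - s) + euler_mascheroni) * s powr (\<alpha> + \<beta> - 2)
              * prabhakar \<alpha> (\<alpha> + \<beta> - 1) (\<gamma> + 1) (lam * s powr \<alpha>)"
  shows "F absolutely_integrable_on {0..t}"
    and "(\<lambda>k. prabhakar_deriv_term \<beta> \<gamma> lam t k \<alpha>) sums (\<gamma> * lam * integral {0..t} F)"
proof -
  define \<delta> where "\<delta> = \<alpha> + \<beta> - 1"
  have \<delta>: "\<delta> > 0" using assms by (simp add: \<delta>_def)
  define y where "y k = \<alpha> * real k + \<delta>" for k
  have y: "y k > 0" for k unfolding y_def using \<delta> assms by (intro add_nonneg_pos) auto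
  define c where "c k = pochhammer (\<gamma> + 1) k / fact k * lam ^ k * rGamma (y k)" for k
  define h where "h k s = (ln (t - s) + euler_mascheroni) * s powr (y k - 1)" for k s
  note h = log_convolution_power[OF \<open>t > 0\<close> y, folded h_def]
  define f where "f k s = c k * h k s" for k s
  have f_abs: "f k absolutely_integrable_on {0..t}" for k
    unfolding f_def using h(1) by (intro set_integrable_mult_right) auto
  have c_over_y: "c k / y k = pochhammer (\<gamma> + 1) k / fact k * lam ^ k * rGamma (\<alpha> * real k + (\<alpha> + \<beta>))" for k
  proof -
    have "y k * rGamma (y k + 1) = rGamma (y k)" by (rule rGamma_plus1)
    moreover have "y k + 1 = \<alpha> * real k + (\<alpha> + \<beta>)" by (simp add: y_def \<delta>_def)
    ultimately show ?thesis using y[of k] by (simp add: c_def field_simps)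
  qed

  obtain D where D: "D \<ge> 0" "\<And>k y. 0 < y \<Longrightarrow> y \<le> (\<alpha> + \<delta>) * (real k + 1) \<Longrightarrow>
    \<bar>ln t\<bar> + euler_mascheroni + (Digamma (y + 1) + euler_mascheroni) \<le> D * 2 ^ k"
    using log_Digamma_growth[of "\<alpha> + \<delta>" t] assms \<delta> by auto
  have y_le: "y k \<le> (\<alpha> + \<delta>) * (real k + 1)" for k
    using assms \<delta> by (simp add: y_def algebra_simps)
  \<comment> \<open>The factor \<open>2\<close> absorbs the growth of the logarithmic factor.\<close>
  define z where "z = 2 * (\<bar>lam\<bar> * t powr \<alpha>)"
  have J: "summable (\<lambda>k. integral {0..t} (\<lambda>s. \<bar>f k s\<bar>))"
  proof (rule summable_comparison_test')
    show "summable (\<lambda>k. t powr \<delta> * D * \<bar>pochhammer (\<gamma> + 1) k * z ^ k / fact k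
        * rGamma (\<alpha> * real k + (\<alpha> + \<beta>))\<bar>)"
      using assms by (intro summable_mult summable_prabhakar_abs) auto
    fix k :: nat
    have "integral {0..t} (\<lambda>s. \<bar>f k s\<bar>) = \<bar>c k\<bar> * integral {0..t} (\<lambda>s. \<bar>h k s\<bar>)"
      by (simp add: f_def abs_mult)
    also have "\<dots> \<le> \<bar>c k\<bar> * (t powr y k / y k * (D * 2 ^ k))"
      using y[of k] by (intro mult_left_mono order.trans[OF h(3)] D(2) y_le) auto
    also have "\<dots> = t powr \<delta> * D * (\<bar>c k / y k\<bar> * ((t powr \<alpha>) ^ k * 2 ^ k))"
    proof -
      have "t powr y k = t powr \<delta> * (t powr \<alpha>) ^ k"
        using assms by (simp add: y_def powr_realpow[symmetric] powr_powr powr_add mult.commute)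
      then show ?thesis using y[of k] by (simp add: abs_divide)
    qed
    also have "\<bar>c k / y k\<bar> * ((t powr \<alpha>) ^ k * 2 ^ k) = \<bar>pochhammer (\<gamma> + 1) k * z ^ k / fact k
        * rGamma (\<alpha> * real k + (\<alpha> + \<beta>))\<bar>"
      unfolding c_over_y z_def by (simp add: abs_mult power_abs power_mult_distrib)
    finally show "norm (integral {0..t} (\<lambda>s. \<bar>f k s\<bar>)) \<le> t powr \<delta> * D *
        \<bar>pochhammer (\<gamma> + 1) k * z ^ k / fact k * rGamma (\<alpha> * real k + (\<alpha> + \<beta>))\<bar>"
      using f_abs[of k] by (simp add: integral_nonneg absolutely_integrable_on_def)
  qed
  have f_eq: "f k s = (ln (t - s) + euler_mascheroni) * s powr (\<alpha> + \<beta> - 2) *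
      (pochhammer (\<gamma> + 1) k * (lam * s powr \<alpha>) ^ k / fact k * rGamma (\<alpha> * real k + (\<alpha> + \<beta> - 1)))"
    if "s \<ge> 0" for k s
  proof (cases "s = 0")
    case False
    have "s powr (y k - 1) = s powr (\<alpha> + \<beta> - 2) * (s powr \<alpha>) ^ k"
      using that False
      by (simp add: y_def \<delta>_def powr_realpow[symmetric] powr_powr powr_add[symmetric] algebra_simps)
    then show ?thesis
      by (simp add: f_def h_def c_def power_mult_distrib) (simp add: y_def \<delta>_def)
  qed (simp add: f_def h_def)
  have ptw: "(\<lambda>k. f k s) sums F s" "summable (\<lambda>k. \<bar>f k s\<bar>)" if "s \<in> {0..t} - {}" for s
  proof -
    have s: "s \<ge> 0" using that by simp
    have S: "summable (\<lambda>k. \<bar>pochhammer (\<gamma> + 1) k * (lam * s powr \<alpha>) ^ k / fact k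
        * rGamma (\<alpha> * real k + (\<alpha> + \<beta> - 1))\<bar>)"
      using assms by (intro summable_prabhakar_abs) auto
    show "(\<lambda>k. f k s) sums F s"
      unfolding f_eq[OF s] F_def using assms by (intro sums_mult prabhakar_sums) auto
    show "summable (\<lambda>k. \<bar>f k s\<bar>)"
      unfolding f_eq[OF s] abs_mult[of "_ * _ powr _"] by (intro summable_mult S)
  qed
  note T = termwise_integral_sums[OF f_abs J negligible_empty ptw]
  show "F absolutely_integrable_on {0..t}" by (rule T(1))
  have term_eq: "\<gamma> * lam * integral {0..t} (f k) = prabhakar_deriv_term \<beta> \<gamma> lam t (Suc k) \<alpha>" for k
  proof -
    define x where "x = \<alpha> * real (Suc k) + \<beta>"
    have x: "x = y k + 1" "\<alpha> * real k + (\<alpha> + \<beta>) = x"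
      by (simp_all add: x_def y_def \<delta>_def algebra_simps)
    have "\<gamma> * lam * integral {0..t} (f k) =
        \<gamma> * lam * (c k / y k) * t powr (x - 1) * (ln t - Digamma x)"
      using x by (simp add: f_def[abs_def] h(2))
    also have "\<gamma> * lam * (c k / y k) =
        pochhammer \<gamma> (Suc k) / fact (Suc k) * lam ^ Suc k * real (Suc k) * rGamma x"
      unfolding c_over_y x by (simp add: pochhammer_rec fact_Suc del: of_nat_Suc)
    finally show ?thesis
      unfolding prabhakar_deriv_term_def x_def[symmetric] by (simp add: mult_ac)
  qed
  \<comment> \<open>The derivative term of index \<open>0\<close> is zero, so the shift loses nothing.\<close>
  have "(\<lambda>k. prabhakar_deriv_term \<beta> \<gamma> lam t (Suc k) \<alpha>) sums (\<gamma> * lam * integral {0..t} F)"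
    using sums_mult[OF T(2), of "\<gamma> * lam"] by (simp add: term_eq)
  then show "(\<lambda>k. prabhakar_deriv_term \<beta> \<gamma> lam t k \<alpha>) sums (\<gamma> * lam * integral {0..t} F)"
    by (subst (asm) sums_Suc_iff) (simp add: prabhakar_deriv_term_def)
qed

theorem theorem16:
  fixes \<alpha> \<beta> \<gamma> lam t :: real
  assumes "\<alpha> > 0" and "\<beta> > 0" and "\<gamma> > 0"
    and "\<alpha> + \<beta> > 1"
    and "t \<ge> 0"
  shows "(\<lambda>s. (ln (t - s) + euler_mascheroni) * s powr (\<alpha> + \<beta> - 2)
              * prabhakar \<alpha> (\<alpha> + \<beta> - 1) (\<gamma> + 1) (lam * s powr \<alpha>))
           absolutely_integrable_on {0..t} \<and>
         ((\<lambda>a. t powr (\<beta> - 1) * prabhakar a \<beta> \<gamma> (lam * t powr a)) has_real_derivative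
            \<gamma> * lam * integral {0..t} (\<lambda>s. (ln (t - s) + euler_mascheroni) * s powr (\<alpha> + \<beta> - 2)
              * prabhakar \<alpha> (\<alpha> + \<beta> - 1) (\<gamma> + 1) (lam * s powr \<alpha>))) (at \<alpha>)"
proof (cases "t = 0")
  case True
  \<comment> \<open>Here \<open>0 powr _ = 0\<close> makes the function of \<open>a\<close> constantly zero, and the integral is over a point.\<close>
  then show ?thesis by (simp add: absolutely_integrable_negligible)
next
  case False
  then have "t > 0" using assms(5) by simp
  with prabhakar_log_convolution[OF assms(1-4), of t lam]
    prabhakar_times_powr_has_derivative[OF assms(1-4), of t lam]
  show ?thesis by (simp add: sums_iff)
qed

end
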